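(* Let $P\subseteq\mathbb{N}$ and let $(\Sigma_P,\sigma_P)$ be the associated spacing shift. If the topological entropy $h_{\sigma_P}$ equals $0$, then $(\Sigma_P,\sigma_P)$ is proximal.
   Context: $\mathbb{N}=\{1,2,3,\dots\}$. Let $\Sigma=\prod_{i=0}^{\infty}\{0,1\}$ be the one-sided full shift on two symbols, with the product topology, a compatible metric $d$, and the shift map $\sigma$, $(\sigma s)_i=s_{i+1}$. For $P\subseteq\mathbb{N}$ the spacing shift is the subshift $\Sigma_P=\{s\in\Sigma:\ s_i=s_j=1\Rightarrow |i-j|\in P\cup\{0\}\}$, and $\sigma_P$ is the restriction of $\sigma$ to $\Sigma_P$; $h_{\sigma_P}$ is its topological entropy. A topological dynamical system $(X,T)$ ($X$ compact metric with metric $d$, $T$ a continuous surjective self-map) is proximal if every pair $(x_1,x_2)\in X\times X$ is a proximal pair, i.e. $\liminf_{n\to\infty}d(T^n(x_1),T^n(x_2))=0$. *)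

theory Defs
  imports "HOL-Analysis.Analysis"
begin

section \<open>Topological dynamical systems\<close>

text \<open>A self-map of a carrier set is given by a function on the whole type; the notions below
  depend only on its values on the carrier.\<close>

definition topological_dynamical_system ::
    "'a set \<Rightarrow> ('a \<Rightarrow> 'a \<Rightarrow> real) \<Rightarrow> ('a \<Rightarrow> 'a) \<Rightarrow> bool" where
  "topological_dynamical_system X d T \<longleftrightarrow>
     Metric_space X d \<and>
     compact_space (Metric_space.mtopology X d) \<and>
     continuous_map (Metric_space.mtopology X d) (Metric_space.mtopology X d) T \<and>
     T ` X = X"

definition proximal_pair ::
    "('a \<Rightarrow> 'a \<Rightarrow> real) \<Rightarrow> ('a \<Rightarrow> 'a) \<Rightarrow> 'a \<Rightarrow> 'a \<Rightarrow> bool" where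
  "proximal_pair d T x y \<longleftrightarrow> liminf (\<lambda>n. ereal (d ((T ^^ n) x) ((T ^^ n) y))) = 0"

definition proximal ::
    "'a set \<Rightarrow> ('a \<Rightarrow> 'a \<Rightarrow> real) \<Rightarrow> ('a \<Rightarrow> 'a) \<Rightarrow> bool" where
  "proximal X d T \<longleftrightarrow>
     topological_dynamical_system X d T \<and> (\<forall>x\<in>X. \<forall>y\<in>X. proximal_pair d T x y)"

section \<open>Topological entropy (Adler--Konheim--McAndrew)\<close>

definition open_cover :: "'a topology \<Rightarrow> 'a set set \<Rightarrow> bool" where
  "open_cover X \<U> \<longleftrightarrow> (\<forall>U\<in>\<U>. openin X U) \<and> \<Union>\<U> = topspace X"

text \<open>\<open>iterated_join X T \<U> n\<close> is the cover
  \<open>\<U> \<or> T\<^sup>-\<^sup>1 \<U> \<or> \<dots> \<or> T\<^sup>-\<^sup>(\<^sup>n\<^sup>-\<^sup>1\<^sup>) \<U>\<close> of \<open>X\<close>.\<close>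

definition iterated_join ::
    "'a topology \<Rightarrow> ('a \<Rightarrow> 'a) \<Rightarrow> 'a set set \<Rightarrow> nat \<Rightarrow> 'a set set" where
  "iterated_join X T \<U> n =
     {{x \<in> topspace X. \<forall>i<n. (T ^^ i) x \<in> A i} | A. \<forall>i<n. A i \<in> \<U>}"

definition min_subcover_card :: "'a topology \<Rightarrow> 'a set set \<Rightarrow> nat" where
  "min_subcover_card X \<U> =
     (LEAST k. \<exists>\<V>\<subseteq>\<U>. finite \<V> \<and> card \<V> = k \<and> \<Union>\<V> = topspace X)"

text \<open>For a continuous self-map of a compact space the sequence
  \<open>ln (min_subcover_card X (iterated_join X T \<U> n))\<close> is subadditive in \<open>n\<close>, so the
  limit of the quotients by \<open>n\<close> exists; it is written as a limsup, which is total.\<close>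

definition cover_entropy :: "'a topology \<Rightarrow> ('a \<Rightarrow> 'a) \<Rightarrow> 'a set set \<Rightarrow> ereal" where
  "cover_entropy X T \<U> =
     limsup (\<lambda>n. ereal (ln (real (min_subcover_card X (iterated_join X T \<U> n))) / real n))"

definition topological_entropy :: "'a topology \<Rightarrow> ('a \<Rightarrow> 'a) \<Rightarrow> ereal" where
  "topological_entropy X T = (SUP \<U>\<in>{\<U>. open_cover X \<U>}. cover_entropy X T \<U>)"

section \<open>Spacing shifts\<close>

definition full_shift_topology :: "(nat \<Rightarrow> nat) topology" where
  "full_shift_topology = product_topology (\<lambda>_. discrete_topology {0, 1}) UNIV"

abbreviation full_shift :: "(nat \<Rightarrow> nat) set" where
  "full_shift \<equiv> topspace full_shift_topology"

definition shift :: "(nat \<Rightarrow> nat) \<Rightarrow> nat \<Rightarrow> nat" where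
  "shift s = (\<lambda>i. s (Suc i))"

definition spacing_shift :: "nat set \<Rightarrow> (nat \<Rightarrow> nat) set" where
  "spacing_shift P =
     {s \<in> full_shift. \<forall>i j. s i = 1 \<and> s j = 1 \<longrightarrow> nat \<bar>int i - int j\<bar> \<in> P \<union> {0}}"

definition spacing_topology :: "nat set \<Rightarrow> (nat \<Rightarrow> nat) topology" where
  "spacing_topology P = subtopology full_shift_topology (spacing_shift P)"

lemma full_shift_eq: "full_shift = {s. \<forall>i. s i \<in> {0, 1}}"
  by (auto simp: full_shift_topology_def PiE_def Pi_def)

lemma topspace_spacing_topology: "topspace (spacing_topology P) = spacing_shift P"
  by (auto simp: spacing_topology_def spacing_shift_def)

lemma continuous_map_coordinate:
  "continuous_map full_shift_topology (discrete_topology {0, 1}) (\<lambda>s. s i)"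
  unfolding full_shift_topology_def by (rule continuous_map_product_projection) simp

lemma continuous_map_shift: "continuous_map full_shift_topology full_shift_topology shift"
  using continuous_map_coordinate
  unfolding shift_def by (subst (2) full_shift_topology_def)
    (simp add: continuous_map_componentwise_UNIV)

lemma closedin_spacing_shift: "closedin full_shift_topology (spacing_shift P)"
proof -
  have cyl: "closedin full_shift_topology {s \<in> full_shift. s i \<in> {0}}" for i
    by (rule closedin_continuous_map_preimage[OF continuous_map_coordinate]) simp
  have pair: "closedin full_shift_topology
      {s \<in> full_shift. s i = 1 \<and> s j = 1 \<longrightarrow> nat \<bar>int i - int j\<bar> \<in> P \<union> {0}}" for i j
  proof (cases "nat \<bar>int i - int j\<bar> \<in> P \<union> {0}")
    case False
    have "s k = 1 \<longleftrightarrow> s k \<noteq> 0" if "s \<in> full_shift" for s k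
    proof -
      have "s k \<in> {0, 1}" using that unfolding full_shift_eq by blast
      then show ?thesis by auto
    qed
    then have "{s \<in> full_shift. s i = 1 \<and> s j = 1 \<longrightarrow> nat \<bar>int i - int j\<bar> \<in> P \<union> {0}}
        = {s \<in> full_shift. s i \<in> {0}} \<union> {s \<in> full_shift. s j \<in> {0}}"
      using False by (intro set_eqI) (simp only: mem_Collect_eq Un_iff singleton_iff, metis)
    then show ?thesis using cyl by (simp only: closedin_Un)
  next
    case True
    then show ?thesis by (simp only: simp_thms Collect_mem_eq closedin_topspace)
  qed
  have "spacing_shift P =
      (\<Inter>i. \<Inter>j. {s \<in> full_shift. s i = 1 \<and> s j = 1 \<longrightarrow> nat \<bar>int i - int j\<bar> \<in> P \<union> {0}})"
    unfolding spacing_shift_def by (intro set_eqI) (simp only: mem_Collect_eq INT_iff, metis UNIV_I)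
  moreover have "closedin full_shift_topology \<dots>"
    by (intro closedin_INT pair) simp_all
  ultimately show ?thesis by (simp only:)
qed

lemma shift_image_spacing_shift: "shift ` spacing_shift P = spacing_shift P"
proof (intro equalityI subsetI)
  fix s assume "s \<in> shift ` spacing_shift P"
  then obtain t where t: "t \<in> spacing_shift P" "s = shift t" by blast
  have "nat \<bar>int i - int j\<bar> \<in> P \<union> {0}" if "s i = 1" "s j = 1" for i j
  proof -
    have "nat \<bar>int (Suc i) - int (Suc j)\<bar> \<in> P \<union> {0}"
      using t that unfolding spacing_shift_def shift_def by blast
    then show ?thesis by simp
  qed
  then show "s \<in> spacing_shift P"
    using t by (simp add: spacing_shift_def full_shift_eq shift_def)
next
  fix s assume s: "s \<in> spacing_shift P"
  define t where "t = (\<lambda>i. case i of 0 \<Rightarrow> 0 | Suc k \<Rightarrow> s k)"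
  have "nat \<bar>int i - int j\<bar> \<in> P \<union> {0}" if t1: "t i = 1" "t j = 1" for i j
  proof -
    obtain k l where "i = Suc k" "j = Suc l" "s k = 1" "s l = 1"
      using t1 unfolding t_def by (auto split: nat.splits)
    then show ?thesis using s by (auto simp: spacing_shift_def)
  qed
  then have "t \<in> spacing_shift P"
    using s by (auto simp: spacing_shift_def full_shift_eq t_def split: nat.splits)
  moreover have "s = shift t" by (simp add: shift_def t_def)
  ultimately show "s \<in> shift ` spacing_shift P" by blast
qed

lemma compact_space_spacing_topology: "compact_space (spacing_topology P)"
proof -
  have "compact_space full_shift_topology"
    unfolding full_shift_topology_def
    by (simp add: compact_space_product_topology compact_space_discrete_topology)
  then show ?thesis
    unfolding spacing_topology_def
    using closedin_spacing_shift closedin_compact_space compact_space_subtopology by blast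
qed

lemma topological_dynamical_system_spacing_shift:
  assumes "Metric_space full_shift d"
    and "Metric_space.mtopology full_shift d = full_shift_topology"
  shows "topological_dynamical_system (spacing_shift P) d shift"
proof -
  have sub: "spacing_shift P \<subseteq> full_shift" by (auto simp: spacing_shift_def)
  interpret Submetric full_shift d "spacing_shift P"
    using assms(1) sub by (simp add: Submetric_def Submetric_axioms_def)
  have top: "Metric_space.mtopology (spacing_shift P) d = spacing_topology P"
    using mtopology_submetric assms(2) by (simp add: spacing_topology_def)
  have "continuous_map (spacing_topology P) (spacing_topology P) shift"
    using continuous_map_from_subtopology[OF continuous_map_shift, of "spacing_shift P"]
      shift_image_spacing_shift[of P] sub
    by (auto simp: spacing_topology_def continuous_map_in_subtopology Int_absorb1)
  then show ?thesis
    unfolding topological_dynamical_system_def top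
    using compact_space_spacing_topology shift_image_spacing_shift sub.Metric_space_axioms
    by blast
qed

end

theory Submission
  imports Defs
begin

text \<open>
  If \<open>x, y \<in> \<Sigma>\<^sub>P\<close> are not a proximal pair, then from some time on the two orbits are never
  simultaneously close to the fixed point \<open>0\<^sup>\<infinity>\<close>, so every window of some fixed length contains
  a one of \<open>x\<close> or of \<open>y\<close>.  Hence one of the two points has ones of positive upper density.
  Turning any of these ones into zeros does not leave \<open>\<Sigma>\<^sub>P\<close>, so a point with \<open>c\<close> ones among its
  first \<open>n\<close> coordinates produces \<open>2\<^sup>c\<close> words of length \<open>n\<close>, and positive upper density forces
  positive entropy.
\<close>

section \<open>Orbits and points of a spacing shift\<close>

lemma funpow_shift: "(shift ^^ n) s i = s (n + i)"
  by (induction n arbitrary: i) (simp_all add: shift_def)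

lemma shift_in_spacing_shift:
  assumes "s \<in> spacing_shift P"
  shows "(shift ^^ n) s \<in> spacing_shift P"
  using assms shift_image_spacing_shift[of P] by (induction n) auto

lemma spacing_shift_values:
  assumes "s \<in> spacing_shift P"
  shows "s i = 0 \<or> s i = 1"
  using assms unfolding spacing_shift_def full_shift_eq by blast

lemma of_bool_in_spacing_shift:
  assumes "s \<in> spacing_shift P" and "A \<subseteq> {i. s i = 1}"
  shows "(\<lambda>i. of_bool (i \<in> A)) \<in> spacing_shift P"
proof -
  have "nat \<bar>int i - int j\<bar> \<in> P \<union> {0}" if "i \<in> A" "j \<in> A" for i j
    using assms that unfolding spacing_shift_def by blast
  then show ?thesis unfolding spacing_shift_def full_shift_eq by simp
qed

section \<open>Zero entropy forces density zero of the ones\<close>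

definition zero_coordinate_cover :: "nat set \<Rightarrow> (nat \<Rightarrow> nat) set set" where
  "zero_coordinate_cover P = (\<lambda>a. {s \<in> spacing_shift P. s 0 = a}) ` {0, 1}"

lemma open_cover_zero_coordinate_cover:
  "open_cover (spacing_topology P) (zero_coordinate_cover P)"
proof -
  have "openin (spacing_topology P) {s \<in> spacing_shift P. s 0 = a}" if "a \<in> {0, 1}" for a
  proof -
    have "openin full_shift_topology {s \<in> full_shift. s 0 \<in> {a}}"
      by (rule openin_continuous_map_preimage[OF continuous_map_coordinate]) (use that in simp)
    moreover have "{s \<in> spacing_shift P. s 0 = a} = {s \<in> full_shift. s 0 \<in> {a}} \<inter> spacing_shift P"
      by (auto simp: spacing_shift_def)
    ultimately show ?thesis
      unfolding spacing_topology_def openin_subtopology by blast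
  qed
  moreover have "\<Union> (zero_coordinate_cover P) = spacing_shift P"
    using spacing_shift_values[of _ P 0] by (auto simp: zero_coordinate_cover_def)
  ultimately show ?thesis
    unfolding open_cover_def topspace_spacing_topology by (auto simp: zero_coordinate_cover_def)
qed

text \<open>The index function \<open>A\<close> lives on all of \<open>nat\<close>, but a member
  depends only on its first \<open>n\<close> values, and there are finitely many functions from
  \<open>{..<n}\<close> into a finite \<open>\<U>\<close>.\<close>

lemma finite_iterated_join:
  assumes "finite \<U>"
  shows "finite (iterated_join X T \<U> n)"
proof (rule finite_subset)
  let ?F = "\<lambda>A. {x \<in> topspace X. \<forall>i<n. (T ^^ i) x \<in> A i}"
  show "iterated_join X T \<U> n \<subseteq> ?F ` ({..<n} \<rightarrow>\<^sub>E \<U>)"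
  proof
    fix W assume "W \<in> iterated_join X T \<U> n"
    then obtain A where A: "W = ?F A" "\<forall>i<n. A i \<in> \<U>"
      by (auto simp: iterated_join_def)
    then have "W = ?F (restrict A {..<n})" "restrict A {..<n} \<in> {..<n} \<rightarrow>\<^sub>E \<U>"
      by auto
    then show "W \<in> ?F ` ({..<n} \<rightarrow>\<^sub>E \<U>)" by blast
  qed
  show "finite (?F ` ({..<n} \<rightarrow>\<^sub>E \<U>))"
    using assms by (intro finite_imageI finite_PiE) auto
qed

lemma Union_iterated_join:
  assumes "\<Union>\<U> = topspace X" and "T ` topspace X \<subseteq> topspace X"
  shows "\<Union> (iterated_join X T \<U> n) = topspace X"
proof
  show "\<Union> (iterated_join X T \<U> n) \<subseteq> topspace X"
    by (auto simp: iterated_join_def)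
next
  show "topspace X \<subseteq> \<Union> (iterated_join X T \<U> n)"
  proof
    fix x assume x: "x \<in> topspace X"
    have "(T ^^ i) x \<in> topspace X" for i
      by (induction i) (use x assms(2) in auto)
    then have "\<forall>i. \<exists>U\<in>\<U>. (T ^^ i) x \<in> U" using assms(1) by blast
    then obtain A where A: "\<And>i. A i \<in> \<U> \<and> (T ^^ i) x \<in> A i" by metis
    then have "x \<in> {x \<in> topspace X. \<forall>i<n. (T ^^ i) x \<in> A i}" using x by simp
    moreover have "{x \<in> topspace X. \<forall>i<n. (T ^^ i) x \<in> A i} \<in> iterated_join X T \<U> n"
      using A unfolding iterated_join_def by blast
    ultimately show "x \<in> \<Union> (iterated_join X T \<U> n)" by blast
  qed
qed

text \<open>A finite cover is one of its own candidates, so the \<open>LEAST\<close> ranges over a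
  nonempty set and is attained.\<close>

lemma min_subcover_card_witness:
  assumes "finite \<U>" and "\<Union>\<U> = topspace X"
  obtains \<V> where "\<V> \<subseteq> \<U>" "finite \<V>" "card \<V> = min_subcover_card X \<U>" "\<Union>\<V> = topspace X"
proof -
  have "\<exists>k. \<exists>\<V>\<subseteq>\<U>. finite \<V> \<and> card \<V> = k \<and> \<Union>\<V> = topspace X"
    using assms by blast
  from LeastI_ex[OF this] show thesis
    using that unfolding min_subcover_card_def by blast
qed

text \<open>The nonempty members of this join are the cylinders of words of length \<open>n\<close>:
  the \<open>i\<close>-th factor prescribes the symbol of \<open>(shift ^^ i) s\<close> at 0, which
  is \<open>s i\<close>.\<close>

lemma iterated_join_zero_coordinate_cover_eqD:
  assumes "W \<in> iterated_join (spacing_topology P) shift (zero_coordinate_cover P) n"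
    and "s \<in> W" "t \<in> W" "i < n"
  shows "s i = t i"
proof -
  obtain A where A: "\<forall>i<n. A i \<in> zero_coordinate_cover P"
      "\<forall>s\<in>W. \<forall>i<n. (shift ^^ i) s \<in> A i"
    using assms(1) by (auto simp: iterated_join_def)
  then obtain a where "A i = {s \<in> spacing_shift P. s 0 = a}"
    using \<open>i < n\<close> by (auto simp: zero_coordinate_cover_def)
  then have "(shift ^^ i) s 0 = a" "(shift ^^ i) t 0 = a" using A assms by blast+
  then show ?thesis by (simp add: funpow_shift)
qed

text \<open>Each set of ones of \<open>s\<close> below \<open>n\<close> is the support of a point of
  the spacing shift. Different sets give points that differ below \<open>n\<close>, so no member of
  the join contains both, and a subcover needs a separate member for each set.\<close>

lemma power_card_ones_le_min_subcover_card:
  assumes "s \<in> spacing_shift P"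
  shows "2 ^ card {i. i < n \<and> s i = 1} \<le>
    min_subcover_card (spacing_topology P)
      (iterated_join (spacing_topology P) shift (zero_coordinate_cover P) n)"
proof -
  let ?X = "spacing_topology P"
  let ?J = "iterated_join ?X shift (zero_coordinate_cover P) n"
  let ?ones = "{i. i < n \<and> s i = 1}"
  have fin: "finite ?J"
    by (rule finite_iterated_join) (simp add: zero_coordinate_cover_def)
  have cov: "\<Union> ?J = topspace ?X"
    using open_cover_zero_coordinate_cover[of P] shift_image_spacing_shift[of P]
    by (intro Union_iterated_join) (simp_all add: open_cover_def topspace_spacing_topology)
  obtain \<V> where \<V>: "\<V> \<subseteq> ?J" "finite \<V>" "card \<V> = min_subcover_card ?X ?J"
      "\<Union>\<V> = spacing_shift P"
    by (rule min_subcover_card_witness[OF fin cov, unfolded topspace_spacing_topology])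
  define ind :: "nat set \<Rightarrow> nat \<Rightarrow> nat" where "ind S = (\<lambda>i. of_bool (i \<in> S))" for S
  have ind: "ind S \<in> \<Union>\<V>" if "S \<in> Pow ?ones" for S
    unfolding ind_def \<V>(4) using that by (intro of_bool_in_spacing_shift[OF assms]) auto
  have "\<forall>S\<in>Pow ?ones. \<exists>V. V \<in> \<V> \<and> ind S \<in> V"
    by (intro ballI) (use ind in \<open>simp only: Union_iff Bex_def\<close>)
  from bchoice[OF this]
  obtain V where V: "\<And>S. S \<in> Pow ?ones \<Longrightarrow> V S \<in> \<V> \<and> ind S \<in> V S" by blast
  have "inj_on V (Pow ?ones)"
  proof (rule inj_onI)
    fix S S' assume S: "S \<in> Pow ?ones" "S' \<in> Pow ?ones" "V S = V S'"
    have "ind S i = ind S' i" if "i < n" for i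
      using V[OF S(1)] V[OF S(2)] S(3) \<V>(1) that
      by (intro iterated_join_zero_coordinate_cover_eqD[of "V S" P n]) auto
    then have "i \<in> S \<longleftrightarrow> i \<in> S'" if "i < n" for i
      using that by (simp add: ind_def of_bool_eq_iff)
    then show "S = S'" using S by blast
  qed
  then have "card (Pow ?ones) \<le> card \<V>"
    using V \<V>(2) by (intro card_inj_on_le) auto
  then show ?thesis by (simp add: card_Pow \<V>(3))
qed

lemma zero_entropy_imp_ones_density_zero:
  assumes "topological_entropy (spacing_topology P) shift = 0"
    and s: "s \<in> spacing_shift P" and "\<epsilon> > 0"
  shows "\<forall>\<^sub>F n in sequentially. real (card {i. i < n \<and> s i = 1}) < \<epsilon> * real n"
proof -
  let ?c = "\<lambda>n. min_subcover_card (spacing_topology P)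
    (iterated_join (spacing_topology P) shift (zero_coordinate_cover P) n)"
  have "cover_entropy (spacing_topology P) shift (zero_coordinate_cover P)
      \<le> topological_entropy (spacing_topology P) shift"
    unfolding topological_entropy_def using open_cover_zero_coordinate_cover
    by (intro SUP_upper) simp
  \<comment> \<open>The factor \<open>ln 2\<close> cancels against the one in the logarithm of
    \<open>2 ^ k\<close>, where \<open>k\<close> is the number of ones below
    \<open>n\<close>.\<close>
  also have "\<dots> < ereal (\<epsilon> * ln 2)" using assms by simp
  finally have "\<forall>\<^sub>F n in sequentially. ereal (ln (real (?c n)) / real n) < ereal (\<epsilon> * ln 2)"
    unfolding cover_entropy_def by (rule Limsup_lessD)
  \<comment> \<open>At \<open>n = 0\<close> the quotient has the default value 0 and the strict
    bound on the count fails, so only positive \<open>n\<close> are considered.\<close>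
  then show ?thesis
    using eventually_gt_at_top[of 0]
  proof eventually_elim
    case (elim n)
    let ?k = "card {i. i < n \<and> s i = 1}"
    have "real ?k * ln 2 = ln (real (2 ^ ?k))" by (simp add: ln_realpow)
    also have "\<dots> \<le> ln (real (?c n))"
    proof (rule ln_mono)
      show "real (2 ^ ?k) \<le> real (?c n)"
        using power_card_ones_le_min_subcover_card[OF s, of n] by (simp only: of_nat_le_iff)
    qed simp
    also have "\<dots> < \<epsilon> * ln 2 * real n" using elim by (simp add: field_simps)
    finally have "real ?k * ln 2 < (\<epsilon> * real n) * ln 2" by (simp add: mult_ac)
    then show ?case by (rule mult_right_less_imp_less) simp
  qed
qed

section \<open>Windows of zeros common to two points\<close>

lemma full_shift_zero_nhd:
  assumes "openin full_shift_topology U" and "(\<lambda>_. 0) \<in> U"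
  obtains L where "\<And>s. s \<in> full_shift \<Longrightarrow> (\<And>i. i < L \<Longrightarrow> s i = 0) \<Longrightarrow> s \<in> U"
proof -
  have "\<exists>W. finite {i \<in> UNIV. W i \<noteq> topspace (discrete_topology {0, 1 :: nat})} \<and>
      (\<forall>i\<in>UNIV. openin (discrete_topology {0, 1}) (W i)) \<and>
      (\<lambda>_. 0) \<in> Pi\<^sub>E UNIV W \<and> Pi\<^sub>E UNIV W \<subseteq> U"
    using assms unfolding full_shift_topology_def openin_product_topology_alt by (rule bspec)
  then obtain W where W: "finite {i. W i \<noteq> {0, 1 :: nat}}" "(\<lambda>_. 0) \<in> Pi\<^sub>E UNIV W"
      "Pi\<^sub>E UNIV W \<subseteq> U"
    unfolding topspace_discrete_topology by auto
  \<comment> \<open>A basic open set of the product restricts only finitely many coordinates;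
    \<open>L\<close> lies beyond all of them.\<close>
  obtain L where L: "\<And>i. W i \<noteq> {0, 1} \<Longrightarrow> i < L"
    using W(1) finite_nat_set_iff_bounded by auto
  show thesis
  proof
    fix s assume s: "s \<in> full_shift" "\<And>i. i < L \<Longrightarrow> s i = 0"
    have "s i \<in> W i" for i
    proof (cases "i < L")
      case True
      then show ?thesis using s(2) W(2) by (auto simp: PiE_iff)
    next
      case False
      then show ?thesis using s(1) L[of i] unfolding full_shift_eq by blast
    qed
    then show "s \<in> U" using W(3) by auto
  qed
qed

text \<open>The \<open>k\<close> consecutive windows of length \<open>L\<close> that start at
  \<open>N\<close> are disjoint, and each contributes an element of \<open>A\<close>.\<close>

lemma card_ge_of_bounded_gaps:
  fixes A :: "nat set"
  assumes "\<And>n. N \<le> n \<Longrightarrow> \<exists>i\<in>A. n \<le> i \<and> i < n + L"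
  shows "k \<le> card {i\<in>A. i < N + k * L}"
proof (induction k)
  case (Suc k)
  obtain i where i: "i \<in> A" "N + k * L \<le> i" "i < N + k * L + L"
    using assms[of "N + k * L"] by auto
  have "Suc k \<le> card (insert i {i\<in>A. i < N + k * L})"
    using Suc i by simp
  also have "\<dots> \<le> card {i\<in>A. i < N + Suc k * L}"
    using i by (intro card_mono) auto
  finally show ?case .
qed simp

text \<open>Otherwise the ones of \<open>x\<close> and of \<open>y\<close> together meet every
  window of length \<open>L\<close> from \<open>N\<close> on, and so have positive density, while
  the ones of each point have density zero.\<close>

lemma zero_entropy_imp_common_zero_window:
  assumes ent: "topological_entropy (spacing_topology P) shift = 0"
    and x: "x \<in> spacing_shift P" and y: "y \<in> spacing_shift P"
  obtains n where "N \<le> n" "\<And>i. i < L \<Longrightarrow> x (n + i) = 0 \<and> y (n + i) = 0"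
proof (rule ccontr)
  note window = that
  assume "\<not> thesis"
  then have *: "\<exists>i<L. x (n + i) \<noteq> 0 \<or> y (n + i) \<noteq> 0" if "N \<le> n" for n
    using window[of n] \<open>N \<le> n\<close> by blast
  let ?A = "{i. x i = 1} \<union> {i. y i = 1}"
  have "\<exists>i\<in>?A. n \<le> i \<and> i < n + L" if "N \<le> n" for n
  proof -
    obtain i where "i < L" "x (n + i) \<noteq> 0 \<or> y (n + i) \<noteq> 0"
      using *[OF \<open>N \<le> n\<close>] by blast
    then have "n + i \<in> ?A"
      using spacing_shift_values[OF x, of "n + i"] spacing_shift_values[OF y, of "n + i"] by auto
    then show ?thesis using \<open>i < L\<close> by (intro bexI[of _ "n + i"]) auto
  qed
  note gaps = this
  \<comment> \<open>An empty window cannot contain a one.\<close>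
  have "L > 0" using gaps[of N] by auto
  \<comment> \<open>\<open>M\<close> absorbs the offset: \<open>N + k * L \<le> k * M\<close> once
    \<open>k \<ge> 1\<close>. With \<epsilon> = 1 / (2 M) each of the two counts of ones is then
    below \<open>k / 2\<close>, against a union of at least \<open>k\<close> elements.\<close>
  define M where "M = N + L"
  have "M > 0" using \<open>L > 0\<close> by (simp add: M_def)
  define \<epsilon> where "\<epsilon> = 1 / (2 * real M)"
  have "\<epsilon> > 0" using \<open>M > 0\<close> by (simp add: \<epsilon>_def)
  from zero_entropy_imp_ones_density_zero[OF ent x this]
       zero_entropy_imp_ones_density_zero[OF ent y this]
  have "\<forall>\<^sub>F n in sequentially. real (card {i. i < n \<and> x i = 1}) < \<epsilon> * real n
      \<and> real (card {i. i < n \<and> y i = 1}) < \<epsilon> * real n"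
    by (rule eventually_conj)
  then obtain K where K: "\<And>n. n \<ge> K \<Longrightarrow> real (card {i. i < n \<and> x i = 1}) < \<epsilon> * real n
      \<and> real (card {i. i < n \<and> y i = 1}) < \<epsilon> * real n"
    unfolding eventually_sequentially by blast
  \<comment> \<open>The successor ensures \<open>k \<ge> 1\<close>, as the bound by
    \<open>k * M\<close> requires; with \<open>L \<ge> 1\<close> it also gives
    \<open>n \<ge> K\<close>.\<close>
  define k where "k = Suc K"
  define n where "n = N + k * L"
  have "k * 1 \<le> k * L" using \<open>L > 0\<close> by (intro mult_left_mono) auto
  then have "K \<le> n" by (simp add: n_def k_def)
  have "k \<le> card {i\<in>?A. i < n}"
    unfolding n_def using gaps by (rule card_ge_of_bounded_gaps)
  also have "{i\<in>?A. i < n} = {i. i < n \<and> x i = 1} \<union> {i. i < n \<and> y i = 1}" by auto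
  also have "card \<dots> \<le> card {i. i < n \<and> x i = 1} + card {i. i < n \<and> y i = 1}"
    by (rule card_Un_le)
  finally have "real k \<le> real (card {i. i < n \<and> x i = 1}) + real (card {i. i < n \<and> y i = 1})"
    by linarith
  also have "\<dots> < 2 * \<epsilon> * real n" using K[OF \<open>K \<le> n\<close>] by linarith
  also have "\<dots> \<le> real k"
  proof -
    have "n \<le> k * M" by (simp add: n_def M_def k_def algebra_simps)
    then have "real n \<le> real k * real M" by (metis of_nat_le_iff of_nat_mult)
    then show ?thesis using \<open>M > 0\<close> by (simp add: \<epsilon>_def field_simps)
  qed
  finally show False by simp
qed

theorem theorem1p6:
  fixes P :: "nat set" and d :: "(nat \<Rightarrow> nat) \<Rightarrow> (nat \<Rightarrow> nat) \<Rightarrow> real"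
  assumes "P \<subseteq> {1..}"
    and "Metric_space full_shift d"
    and "Metric_space.mtopology full_shift d = full_shift_topology"
    and "topological_entropy (spacing_topology P) shift = 0"
  shows "proximal (spacing_shift P) d shift"
proof -
  interpret Metric_space full_shift d by (fact assms(2))
  have zero: "(\<lambda>_. 0) \<in> full_shift" by (simp add: full_shift_eq)
  have "proximal_pair d shift x y" if x: "x \<in> spacing_shift P" and y: "y \<in> spacing_shift P" for x y
  proof (rule ccontr)
    let ?d = "\<lambda>n. ereal (d ((shift ^^ n) x) ((shift ^^ n) y))"
    assume "\<not> proximal_pair d shift x y"
    moreover have "0 \<le> liminf ?d" by (intro Liminf_bounded always_eventually) simp
    ultimately have "0 < liminf ?d" by (auto simp: proximal_pair_def)
    then obtain \<delta> where \<delta>: "0 < ereal \<delta>" "ereal \<delta> < liminf ?d"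
      using ereal_dense2 by blast
    then obtain N where N: "\<And>n. N \<le> n \<Longrightarrow> \<delta> < d ((shift ^^ n) x) ((shift ^^ n) y)"
      using less_LiminfD[OF \<delta>(2)] unfolding eventually_sequentially by auto
    \<comment> \<open>The metric is an arbitrary compatible one, so closeness to the zero sequence
      is read off the topology: this ball contains every point with a long enough initial block of
      zeros. The radius is halved for the triangle inequality through the zero sequence.\<close>
    have "openin full_shift_topology (mball (\<lambda>_. 0) (\<delta> / 2))"
      using openin_mball assms(3) by simp
    moreover have "(\<lambda>_. 0) \<in> mball (\<lambda>_. 0) (\<delta> / 2)" using zero \<delta>(1) by simp
    ultimately obtain L where
      L: "\<And>s. s \<in> full_shift \<Longrightarrow> (\<And>i. i < L \<Longrightarrow> s i = 0) \<Longrightarrow> s \<in> mball (\<lambda>_. 0) (\<delta> / 2)"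
      using full_shift_zero_nhd by blast
    obtain n where n: "N \<le> n" "\<And>i. i < L \<Longrightarrow> x (n + i) = 0 \<and> y (n + i) = 0"
      using zero_entropy_imp_common_zero_window[OF assms(4) x y] by blast
    let ?x = "(shift ^^ n) x" and ?y = "(shift ^^ n) y"
    have X: "?x \<in> full_shift" and Y: "?y \<in> full_shift"
      using shift_in_spacing_shift[OF x] shift_in_spacing_shift[OF y]
      by (auto simp: spacing_shift_def)
    have "d (\<lambda>_. 0) ?x < \<delta> / 2" "d (\<lambda>_. 0) ?y < \<delta> / 2"
      using L[OF X] L[OF Y] n(2) by (auto simp: funpow_shift)
    then have "d ?x ?y < \<delta>" using triangle[OF X zero Y] commute[of ?x "\<lambda>_. 0"] by simp
    then show False using N[OF n(1)] by simp
  qed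
  then show ?thesis
    unfolding proximal_def
    using topological_dynamical_system_spacing_shift[OF assms(2,3)] by blast
qed

end
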